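(* Let $k$ be a (commutative, unital) Noetherian ring, and let $\mathrm{FI}_{\mathcal{W}}$ be any of $\mathrm{FI}_A$, $\mathrm{FI}_{BC}$, $\mathrm{FI}_D$. Then any sub-$\mathrm{FI}_{\mathcal{W}}$-module of a finitely generated $\mathrm{FI}_{\mathcal{W}}$-module over $k$ is itself finitely generated.
   Context: For $n\ge 0$ let $\mathbf{n}=\{\pm1,\dots,\pm n\}$, $\mathbf{0}=\varnothing$. $\mathrm{FI}_{BC}$ is the category with objects $\mathbf{n}$ and morphisms $\mathbf{m}\to\mathbf{n}$ the injections $f$ with $f(-a)=-f(a)$ for all $a$. $\mathrm{FI}_D$ is the subcategory with the same objects and the same morphisms except that an isomorphism must reverse an even number of signs. $\mathrm{FI}_A$ is the subcategory with the same objects and with only the sign-preserving morphisms. An $\mathrm{FI}_{\mathcal{W}}$-module over $k$ is a covariant functor $V:\mathrm{FI}_{\mathcal{W}}\to k\text{-Mod}$; $V_n:=V(\mathbf{n})$. Sub-$\mathrm{FI}_{\mathcal{W}}$-modules are subfunctors. $V$ is finitely generated if there is a finite set of elements of $\coprod_{n\ge0}V_n$ not contained in any proper sub-$\mathrm{FI}_{\mathcal{W}}$-module. *)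

theory Defs
  imports "HOL-Algebra.Algebra" "HOL-Library.FuncSet"
begin

definition pm :: "nat \<Rightarrow> int set" where
  "pm n = {a. a \<noteq> 0 \<and> \<bar>a\<bar> \<le> int n}"

(* Morphisms are extensional functions (undefined outside the source pm m), so that equality of
   morphisms m -> n is equality in HOL. An extensional function does not determine its target,
   so source and target are carried along explicitly wherever a functor is applied. *)
definition hom_BC :: "nat \<Rightarrow> nat \<Rightarrow> (int \<Rightarrow> int) set" where
  "hom_BC m n = {f \<in> pm m \<rightarrow>\<^sub>E pm n. inj_on f (pm m) \<and> (\<forall>a\<in>pm m. f (- a) = - f a)}"

(* Signs are counted once per pair {a, -a}, i.e. over the positive a. The bijections are exactly
   the isomorphisms of FI_BC, see bij_betw_iff_iso below. *)
definition hom_D :: "nat \<Rightarrow> nat \<Rightarrow> (int \<Rightarrow> int) set" where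
  "hom_D m n = {f \<in> hom_BC m n.
     bij_betw f (pm m) (pm n) \<longrightarrow> even (card {a \<in> pm m. a > 0 \<and> f a < 0})}"

definition hom_A :: "nat \<Rightarrow> nat \<Rightarrow> (int \<Rightarrow> int) set" where
  "hom_A m n = {f \<in> hom_BC m n. \<forall>a\<in>pm m. sgn (f a) = sgn a}"

datatype weyl_type = Type_A | Type_BC | Type_D

fun FI_hom :: "weyl_type \<Rightarrow> nat \<Rightarrow> nat \<Rightarrow> (int \<Rightarrow> int) set" where
  "FI_hom Type_A = hom_A"
| "FI_hom Type_BC = hom_BC"
| "FI_hom Type_D = hom_D"

definition FI_id :: "nat \<Rightarrow> int \<Rightarrow> int" where
  "FI_id n = (\<lambda>a\<in>pm n. a)"

definition module_hom ::
  "('k, 'c) ring_scheme \<Rightarrow> ('k, 'm, 'd) module_scheme \<Rightarrow> ('k, 'm, 'e) module_scheme \<Rightarrow> ('m \<Rightarrow> 'm) set"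
  where
  "module_hom R M N = {h \<in> carrier M \<rightarrow> carrier N.
     (\<forall>x\<in>carrier M. \<forall>y\<in>carrier M. h (x \<oplus>\<^bsub>M\<^esub> y) = h x \<oplus>\<^bsub>N\<^esub> h y) \<and>
     (\<forall>r\<in>carrier R. \<forall>x\<in>carrier M. h (r \<odot>\<^bsub>M\<^esub> x) = r \<odot>\<^bsub>N\<^esub> h x)}"

(* V n is the module V_n, and act m n f : V_m -> V_n is the map induced by f : m -> n. *)
locale FI_module =
  fixes R :: "('k, 'c) ring_scheme"
    and W :: weyl_type
    and V :: "nat \<Rightarrow> ('k, 'm, 'd) module_scheme"
    and act :: "nat \<Rightarrow> nat \<Rightarrow> (int \<Rightarrow> int) \<Rightarrow> 'm \<Rightarrow> 'm"
  assumes module_V: "module R (V n)"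
    and act_hom: "f \<in> FI_hom W m n \<Longrightarrow> act m n f \<in> module_hom R (V m) (V n)"
    and act_id: "x \<in> carrier (V n) \<Longrightarrow> act n n (FI_id n) x = x"
    and act_comp: "\<lbrakk>f \<in> FI_hom W l m; g \<in> FI_hom W m n; x \<in> carrier (V l)\<rbrakk>
      \<Longrightarrow> act l n (compose (pm l) g f) x = act m n g (act l m f x)"

definition sub_FI_module ::
  "(nat \<Rightarrow> 'm set) \<Rightarrow> ('k, 'c) ring_scheme \<Rightarrow> weyl_type \<Rightarrow> (nat \<Rightarrow> ('k, 'm, 'd) module_scheme)
     \<Rightarrow> (nat \<Rightarrow> nat \<Rightarrow> (int \<Rightarrow> int) \<Rightarrow> 'm \<Rightarrow> 'm) \<Rightarrow> bool" where
  "sub_FI_module U R W V act \<longleftrightarrow>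
     (\<forall>n. submodule (U n) R (V n)) \<and>
     (\<forall>m n. \<forall>f\<in>FI_hom W m n. act m n f ` U m \<subseteq> U n)"

definition restrict_FI ::
  "(nat \<Rightarrow> ('k, 'm, 'd) module_scheme) \<Rightarrow> (nat \<Rightarrow> 'm set) \<Rightarrow> nat \<Rightarrow> ('k, 'm, 'd) module_scheme" where
  "restrict_FI V U = (\<lambda>n. (V n)\<lparr>carrier := U n\<rparr>)"

(* The pair (n, x) stands for the element x of the summand V_n in the disjoint union of the V_n. *)
definition fin_gen_FI ::
  "('k, 'c) ring_scheme \<Rightarrow> weyl_type \<Rightarrow> (nat \<Rightarrow> ('k, 'm, 'd) module_scheme)
     \<Rightarrow> (nat \<Rightarrow> nat \<Rightarrow> (int \<Rightarrow> int) \<Rightarrow> 'm \<Rightarrow> 'm) \<Rightarrow> bool" where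
  "fin_gen_FI R W V act \<longleftrightarrow>
     (\<exists>S. finite S \<and> S \<subseteq> (SIGMA n:UNIV. carrier (V n)) \<and>
       \<not> (\<exists>U. sub_FI_module U R W V act \<and> U \<noteq> (\<lambda>n. carrier (V n)) \<and> S \<subseteq> (SIGMA n:UNIV. U n)))"

lemma pm_uminus [simp]: "- a \<in> pm n \<longleftrightarrow> a \<in> pm n"
  by (simp add: pm_def)

lemma finite_pm [simp]: "finite (pm n)"
  by (rule finite_subset[of _ "{- int n..int n}"]) (auto simp: pm_def)

lemma hom_BC_comp:
  assumes "f \<in> hom_BC l m" "g \<in> hom_BC m n"
  shows "compose (pm l) g f \<in> hom_BC l n"
proof -
  have f: "f \<in> pm l \<rightarrow> pm m" using assms(1) by (auto simp: hom_BC_def)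
  have "inj_on (compose (pm l) g f) (pm l)"
    using assms f by (auto simp: hom_BC_def inj_on_def compose_def Pi_def)
  moreover have "compose (pm l) g f \<in> pm l \<rightarrow>\<^sub>E pm n"
    using assms f by (auto simp: hom_BC_def compose_def PiE_def Pi_def)
  ultimately show ?thesis
    using assms f by (auto simp: hom_BC_def compose_def Pi_def)
qed

lemma bij_betw_iff_iso:
  assumes f: "f \<in> hom_BC m n"
  shows "bij_betw f (pm m) (pm n) \<longleftrightarrow>
    (\<exists>g\<in>hom_BC n m. compose (pm m) g f = FI_id m \<and> compose (pm n) f g = FI_id n)"
proof
  assume b: "bij_betw f (pm m) (pm n)"
  define g where "g = (\<lambda>b\<in>pm n. inv_into (pm m) f b)"
  have bg: "bij_betw g (pm n) (pm m)"
    unfolding g_def using bij_betw_inv_into[OF b] by (simp add: bij_betw_def inj_on_def)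
  have gf: "g (f a) = a" if "a \<in> pm m" for a
    using that b by (auto simp: g_def bij_betw_def)
  have fg: "f (g a) = a" if "a \<in> pm n" for a
    using that b by (auto simp: g_def bij_betw_def f_inv_into_f)
  have gm: "g a \<in> pm m" if "a \<in> pm n" for a
    using that bg by (auto simp: bij_betw_def)
  have "g (- a) = - g a" if "a \<in> pm n" for a
  proof -
    have "f (- g a) = - a" using f gm[OF that] fg[OF that] by (simp add: hom_BC_def)
    moreover have "- g a \<in> pm m" using gm[OF that] by simp
    ultimately show ?thesis using gf by metis
  qed
  moreover have "g \<in> pm n \<rightarrow>\<^sub>E pm m"
    using gm by (auto simp: g_def)
  ultimately have "g \<in> hom_BC n m"
    using bg by (auto simp: hom_BC_def bij_betw_def)
  moreover have "compose (pm m) g f = FI_id m" "compose (pm n) f g = FI_id n"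
    using gf fg by (auto simp: compose_def FI_id_def)
  ultimately show "\<exists>g\<in>hom_BC n m. compose (pm m) g f = FI_id m \<and> compose (pm n) f g = FI_id n"
    by blast
next
  assume "\<exists>g\<in>hom_BC n m. compose (pm m) g f = FI_id m \<and> compose (pm n) f g = FI_id n"
  then obtain g where g: "g \<in> hom_BC n m" "compose (pm n) f g = FI_id n" by blast
  have "b \<in> f ` pm m" if "b \<in> pm n" for b
  proof -
    have "f (g b) = b" using fun_cong[OF g(2), of b] that by (simp add: compose_def FI_id_def)
    moreover have "g b \<in> pm m" using g(1) that by (auto simp: hom_BC_def)
    ultimately show ?thesis by (metis imageI)
  qed
  then show "bij_betw f (pm m) (pm n)"
    using f by (auto simp: bij_betw_def hom_BC_def)
qed

lemma FI_id_in_hom: "FI_id n \<in> FI_hom W n n"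
proof -
  have BC: "FI_id n \<in> hom_BC n n"
    by (auto simp: FI_id_def hom_BC_def inj_on_def)
  have "{a \<in> pm n. a > 0 \<and> FI_id n a < 0} = {}" by (auto simp: FI_id_def)
  then have "FI_id n \<in> hom_D n n"
    using BC unfolding hom_D_def by (simp only: mem_Collect_eq card.empty) simp
  moreover have "FI_id n \<in> hom_A n n"
    using BC by (simp add: hom_A_def FI_id_def)
  ultimately show ?thesis
    using BC by (cases W) simp_all
qed

lemma FI_comp_in_hom:
  assumes f: "f \<in> FI_hom W l m" and g: "g \<in> FI_hom W m n"
  shows "compose (pm l) g f \<in> FI_hom W l n"
proof (cases W)
  case Type_BC
  then show ?thesis using assms hom_BC_comp by simp
next
  case Type_A
  then have "f \<in> pm l \<rightarrow> pm m" using f by (auto simp: hom_A_def hom_BC_def)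
  then show ?thesis
    using Type_A assms hom_BC_comp[of f l m g n] by (auto simp: hom_A_def compose_def Pi_def)
next
  case Type_D
  have fB: "f \<in> hom_BC l m" and gB: "g \<in> hom_BC m n"
    using Type_D assms by (auto simp: hom_D_def)
  have fp: "f a \<in> pm m" if "a \<in> pm l" for a using fB that by (auto simp: hom_BC_def)
  have fneg: "f (- a) = - f a" if "a \<in> pm l" for a using fB that by (auto simp: hom_BC_def)
  have gneg: "g (- a) = - g a" if "a \<in> pm m" for a using gB that by (auto simp: hom_BC_def)
  have finj: "inj_on f (pm l)" and ginj: "inj_on g (pm m)"
    using fB gB by (auto simp: hom_BC_def)
  define h where "h = compose (pm l) g f"
  have h: "h a = g (f a)" if "a \<in> pm l" for a using that by (simp add: h_def compose_def)
  have nz: "b \<noteq> 0" if "b \<in> pm i" for b i using that by (simp add: pm_def)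
  have gp: "g b \<in> pm n" if "b \<in> pm m" for b using gB that by (auto simp: hom_BC_def)
  have "even (card {a \<in> pm l. a > 0 \<and> h a < 0})" if b: "bij_betw h (pm l) (pm n)"
  proof -
    have img: "h ` pm l = g ` (f ` pm l)" using h by (auto simp: image_def)
    have gs: "g ` pm m \<subseteq> pm n" and fs: "f ` pm l \<subseteq> pm m" using gp fp by auto
    have hs: "g ` (f ` pm l) = pm n" using b img by (simp add: bij_betw_def)
    have gim: "g ` pm m = pm n" using hs gs fs by blast
    have fim: "f ` pm l = pm m"
      using inj_on_image_eq_iff[OF ginj fs subset_refl] hs gim by simp
    have fb: "bij_betw f (pm l) (pm m)" and gb: "bij_betw g (pm m) (pm n)"
      using fim gim finj ginj by (auto simp: bij_betw_def)
    define P where "P = {a \<in> pm l. a > 0}"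
    define A where "A = {a \<in> P. f a < 0}"
    define B where "B = {a \<in> P. g \<bar>f a\<bar> < 0}"
    have finP: "finite P" by (simp add: P_def)
    have finA: "finite A" and finB: "finite B" using finP by (auto simp: A_def B_def)
    have eA: "even (card A)"
      using f Type_D fb by (simp add: hom_D_def A_def P_def conj_assoc)
    have "(\<lambda>a. \<bar>f a\<bar>) ` B = {b \<in> pm m. b > 0 \<and> g b < 0}"
    proof (intro equalityI subsetI)
      fix b assume "b \<in> (\<lambda>a. \<bar>f a\<bar>) ` B"
      then obtain a where a: "a \<in> B" "b = \<bar>f a\<bar>" by blast
      then have "f a \<in> pm m" using fp by (simp add: B_def P_def)
      then show "b \<in> {b \<in> pm m. b > 0 \<and> g b < 0}" using a by (auto simp: B_def pm_def)
    next
      fix b assume b: "b \<in> {b \<in> pm m. b > 0 \<and> g b < 0}"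
      then have "b \<in> f ` pm l" using fim by simp
      then obtain a where a: "a \<in> pm l" "f a = b" by blast
      have "\<bar>a\<bar> = a \<or> \<bar>a\<bar> = - a" by arith
      then have "f \<bar>a\<bar> = b \<or> f \<bar>a\<bar> = - b" using a fneg[OF a(1)] by metis
      moreover have "b > 0" "g b < 0" using b by simp_all
      ultimately have fab: "\<bar>f \<bar>a\<bar>\<bar> = b" by (elim disjE) simp_all
      have "\<bar>a\<bar> \<in> pm l" "\<bar>a\<bar> > 0" using a(1) by (simp_all add: pm_def)
      then have "\<bar>a\<bar> \<in> B" using fab \<open>g b < 0\<close> by (simp add: B_def P_def)
      then show "b \<in> (\<lambda>a. \<bar>f a\<bar>) ` B" using fab by (intro image_eqI[where x = "\<bar>a\<bar>"]) simp_all
    qed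
    moreover have "inj_on (\<lambda>a. \<bar>f a\<bar>) B"
    proof (rule inj_onI)
      fix x y assume xy: "x \<in> B" "y \<in> B" "\<bar>f x\<bar> = \<bar>f y\<bar>"
      then have p: "x \<in> pm l" "y \<in> pm l" "x > 0" "y > 0" by (auto simp: B_def P_def)
      from xy(3) have "f x = f y \<or> f x = f (- y)" using fneg[OF p(2)] by (auto simp: abs_eq_iff)
      moreover have "- y \<in> pm l" using p(2) by simp
      ultimately have "x = y \<or> x = - y" using inj_onD[OF finj] p(1,2) by blast
      then show "x = y" using p by auto
    qed
    ultimately have eB: "even (card B)"
      using g Type_D gb card_image[of "\<lambda>a. \<bar>f a\<bar>" B] by (simp add: hom_D_def)
    have sw: "{a \<in> pm l. a > 0 \<and> h a < 0} = (A - B) \<union> (B - A)"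
    proof -
      have "h a < 0 \<longleftrightarrow> (f a < 0) \<noteq> (g \<bar>f a\<bar> < 0)" if "a \<in> pm l" for a
        using h[OF that] gneg[OF fp[OF that]] nz[OF gp[OF fp[OF that]]] by (auto simp: abs_if)
      then show ?thesis by (auto simp: A_def B_def P_def)
    qed
    have "card A = card (A \<inter> B) + card (A - B)"
      using card_Int_Diff[OF finA] .
    moreover have "card B = card (A \<inter> B) + card (B - A)"
      using card_Int_Diff[OF finB, of A] by (simp add: Int_commute)
    moreover have "card ((A - B) \<union> (B - A)) = card (A - B) + card (B - A)"
      using finA finB by (intro card_Un_disjoint) auto
    ultimately show ?thesis using eA eB sw by (metis even_add)
  qed
  then show ?thesis
    using Type_D hom_BC_comp[OF fB gB] by (simp add: hom_D_def h_def)
qed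

lemma restrict_FI_module:
  assumes "FI_module R W V act" "sub_FI_module U R W V act"
  shows "FI_module R W (restrict_FI V U) act"
proof -
  interpret FI_module R W V act by fact
  have U: "submodule (U n) R (V n)" for n using assms(2) by (simp add: sub_FI_module_def)
  have sub: "U n \<subseteq> carrier (V n)" for n
    using submodule.axioms(1)[OF U] subgroup.subset[of "U n" "add_monoid (V n)"] by simp
  have st: "act m n f x \<in> U n" if "f \<in> FI_hom W m n" "x \<in> U m" for m n f x
    using assms(2) that unfolding sub_FI_module_def by blast
  show ?thesis
  proof (rule FI_module.intro)
    show "module R (restrict_FI V U n)" for n
      using submodule.submodule_is_module[OF U module_V] by (simp add: restrict_FI_def)
    show "act m n f \<in> module_hom R (restrict_FI V U m) (restrict_FI V U n)"
      if "f \<in> FI_hom W m n" for f m n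
      using act_hom[OF that] st[OF that] sub by (auto simp: module_hom_def restrict_FI_def subset_iff)
  qed (use sub act_id act_comp in \<open>auto simp: restrict_FI_def subset_iff\<close>)
qed

end

(* A Groebner basis argument. Write OI for the order-preserving, sign-preserving morphisms. A morphism
   f : m -> n is an OI morphism after a morphism m -> m or m -> m + 1 of the same type; there are only
   finitely many of the latter, so V_n is spanned by the OI translates of finitely many elements
   x_1, ..., x_s. Order these translates f x_i by (i, f) lexicographically. Composing with an OI morphism
   preserves this order, so the ideal of leading coefficients of U at f x_i can only grow when f is
   replaced by h f. An OI morphism f : d -> n is determined by its d + 1 gaps, and g = h f is solvable
   for h exactly when the gaps of f are at most those of g; hence Dickson's lemma and the ascending chain
   condition leave finitely many leading ideals to be generated, and a submodule is determined by its
   leading ideals. *)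
theory Submission
  imports Defs "HOL-Library.List_Lexorder" "HOL-Library.Product_Lexorder"
begin

section \<open>Well-quasi-orders and ascending chains\<close>

text \<open>Some subsequence is monotone. If it is not increasing it is decreasing, hence constant
  from the index at which it attains its least value; the tail from there is increasing.\<close>

lemma nat_seq_incseq_subseq:
  fixes s :: "nat \<Rightarrow> nat"
  shows "\<exists>r::nat \<Rightarrow> nat. strict_mono r \<and> incseq (\<lambda>n. s (r n))"
proof -
  obtain r :: "nat \<Rightarrow> nat" where r: "strict_mono r" "monoseq (\<lambda>n. s (r n))"
    using seq_monosub by blast
  show ?thesis
  proof (cases "incseq (\<lambda>n. s (r n))")
    case False
    then have dec: "decseq (\<lambda>n. s (r n))"
      using r(2) by (simp add: monoseq_iff)
    define m where "m = (LEAST x. \<exists>n. x = s (r n))"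
    have "\<exists>n. m = s (r n)" unfolding m_def by (rule LeastI_ex) blast
    then obtain N where N: "m = s (r N)" by blast
    have "s (r n) = m" if "N \<le> n" for n
    proof -
      have "m \<le> s (r n)" unfolding m_def by (rule Least_le) blast
      moreover have "s (r n) \<le> m" using dec that N by (simp add: decseq_def)
      ultimately show ?thesis by simp
    qed
    then have "incseq (\<lambda>n. s (r (n + N)))" by (simp add: incseq_def)
    moreover have "strict_mono (\<lambda>n. r (n + N))"
      using r(1) by (simp add: strict_mono_def)
    ultimately show ?thesis by blast
  qed (use r in blast)
qed

text \<open>Dickson's lemma in sequence form: the sequence is thinned out one coordinate at a time,
  and passing to a further subsequence keeps the earlier coordinates increasing.\<close>

lemma simultaneous_incseq_subseq:
  fixes s :: "nat \<Rightarrow> nat \<Rightarrow> nat"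
  shows "\<exists>r::nat \<Rightarrow> nat. strict_mono r \<and> (\<forall>j<k. incseq (\<lambda>n. s (r n) j))"
proof (induction k)
  case 0
  show ?case by (rule exI[of _ id]) (simp add: strict_mono_def)
next
  case (Suc k)
  then obtain r :: "nat \<Rightarrow> nat" where r: "strict_mono r" "\<forall>j<k. incseq (\<lambda>n. s (r n) j)" by blast
  obtain q :: "nat \<Rightarrow> nat" where q: "strict_mono q" "incseq (\<lambda>n. s (r (q n)) k)"
    using nat_seq_incseq_subseq[of "\<lambda>n. s (r n) k"] by blast
  have "strict_mono (\<lambda>n. r (q n))"
    using r(1) q(1) by (simp add: strict_mono_def)
  moreover have "incseq (\<lambda>n. s (r (q n)) j)" if "j < Suc k" for j
  proof (cases "j = k")
    case False
    then have "incseq (\<lambda>n. s (r n) j)" using that r(2) by simp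
    then show ?thesis using q(1) by (simp add: incseq_def strict_mono_less_eq)
  qed (use q in simp)
  ultimately show ?case by blast
qed

text \<open>If no finite \<open>F\<close> worked, elements could be picked greedily, each bad for
  all earlier ones. Along an increasing subsequence the ideals form an ascending chain, and where it
  becomes stationary an earlier pick serves a later one.\<close>

lemma finite_basis:
  fixes le :: "'a \<Rightarrow> 'a \<Rightarrow> bool" and I :: "'a \<Rightarrow> 'k set"
  assumes subseq: "\<And>s::nat \<Rightarrow> 'a. range s \<subseteq> M \<Longrightarrow>
      \<exists>r::nat \<Rightarrow> nat. strict_mono r \<and> (\<forall>i j. i < j \<longrightarrow> le (s (r i)) (s (r j)))"
    and mono: "\<And>x y. \<lbrakk>x \<in> M; y \<in> M; le x y\<rbrakk> \<Longrightarrow> I x \<subseteq> I y"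
    and R: "noetherian_ring R" and ideal: "\<And>x. x \<in> M \<Longrightarrow> ideal (I x) R"
  shows "\<exists>F \<subseteq> M. finite F \<and> (\<forall>y\<in>M. \<exists>x\<in>F. le x y \<and> I x = I y)"
proof (rule ccontr)
  assume neg: "\<not> ?thesis"
  have bad: "\<exists>y\<in>M. \<forall>x\<in>F. \<not> (le x y \<and> I x = I y)" if "F \<subseteq> M" "finite F" for F
  proof (rule ccontr)
    assume "\<not> ?thesis"
    then have "\<forall>y\<in>M. \<exists>x\<in>F. le x y \<and> I x = I y" by simp
    then have "F \<subseteq> M \<and> finite F \<and> (\<forall>y\<in>M. \<exists>x\<in>F. le x y \<and> I x = I y)"
      using that by (intro conjI)
    then show False using neg by (elim notE) (rule exI)
  qed
  define Q where "Q F y \<longleftrightarrow> y \<in> M \<and> (\<forall>x\<in>F. \<not> (le x y \<and> I x = I y))" for F y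
  define c where "c F = (SOME y. Q F y)" for F
  \<comment> \<open>\<open>t n\<close> is the set of the first \<open>n\<close> picks, so
    \<open>s n\<close> below is an element that is bad for every earlier pick.\<close>
  define t where "t = rec_nat {} (\<lambda>_ F. insert (c F) F)"
  have c: "Q F (c F)" if "F \<subseteq> M" "finite F" for F
    unfolding c_def by (rule someI_ex) (use bad[OF that] in \<open>simp add: Q_def Bex_def\<close>)
  have t: "t n \<subseteq> M \<and> finite (t n)" for n
  proof (induction n)
    case (Suc n)
    then have "c (t n) \<in> M" using c[of "t n"] by (simp add: Q_def)
    then show ?case using Suc by (simp add: t_def)
  qed (simp add: t_def)
  define s where "s n = c (t n)" for n
  have s: "Q (t n) (s n) \<and> t (Suc n) = insert (s n) (t n)" for n
    using c t by (simp add: s_def t_def)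
  have mem: "s i \<in> t n" if "i < n" for i n
    using that s by (induction n) (auto simp: less_Suc_eq)
  have sM: "s n \<in> M" for n using s[of n] by (simp add: Q_def)
  obtain r :: "nat \<Rightarrow> nat" where r: "strict_mono r" "\<And>i j. i < j \<Longrightarrow> le (s (r i)) (s (r j))"
    using subseq[of s] sM by blast
  define J where "J n = I (s (r n))" for n
  have J: "J i \<subseteq> J j" if "i \<le> j" for i j
    using that r(2)[of i j] mono[OF sM sM] by (cases "i = j") (auto simp: J_def)
  \<comment> \<open>The chain condition is used in the form that the union of a nonempty chain of
    ideals belongs to the chain; the index attaining it is where \<open>J\<close> becomes
    stationary.\<close>
  have "\<Union>(range J) \<in> range J"
  proof (rule noetherian_ring.ideal_chain_is_trivial[OF R])
    have "J i \<subset> J j \<or> J j \<subset> J i \<or> J i = J j" for i j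
      using J[of i j] J[of j i] linear[of i j] by blast
    then show "subset.chain {I. ideal I R} (range J)"
      using ideal[OF sM] by (auto simp: subset.chain_def J_def)
  qed simp
  then obtain N where "\<Union>(range J) = J N" by auto
  moreover have "J (Suc N) \<subseteq> \<Union>(range J)" by blast
  ultimately have "J (Suc N) = J N" using J[of N "Suc N"] by simp
  moreover have "le (s (r N)) (s (r (Suc N)))" using r(2) by simp
  moreover have "r N < r (Suc N)" using r(1) by (simp add: strict_mono_def)
  ultimately show False using mem[of "r N" "r (Suc N)"] s[of "r (Suc N)"] unfolding Q_def J_def by metis
qed

section \<open>Order-preserving injections\<close>

text \<open>The list \<open>fs\<close> stands for the map sending \<open>a\<close> to \<open>fs ! (a - 1)\<close>, for \<open>a\<close> in \<open>{1..d}\<close>;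
  \<open>push hs fs\<close> is then the composite \<open>hs\<close> after \<open>fs\<close>. The gaps are those of \<open>fs\<close> extended by \<open>0\<close> at \<open>0\<close>
  and by \<open>n + 1\<close> at \<open>d + 1\<close>.\<close>
definition OI :: "nat \<Rightarrow> nat \<Rightarrow> nat list set" where
  "OI d n = {fs. length fs = d \<and> sorted_wrt (<) fs \<and> set fs \<subseteq> {1..n}}"

definition push :: "nat list \<Rightarrow> nat list \<Rightarrow> nat list" where
  "push hs fs = map (\<lambda>b. hs ! (b - 1)) fs"

definition gap :: "nat \<Rightarrow> nat list \<Rightarrow> nat \<Rightarrow> nat" where
  "gap n fs j = (0 # fs @ [Suc n]) ! Suc j - (0 # fs @ [Suc n]) ! j"

lemma finite_OI: "finite (OI d n)"
  by (rule finite_subset[OF _ finite_lists_length_eq[of "{1..n}" d]]) (auto simp: OI_def)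

lemma OI_nth_less:
  assumes "hs \<in> OI n n'" "a \<in> {1..n}" "b \<in> {1..n}" "a < b"
  shows "hs ! (a - 1) < hs ! (b - 1)"
proof -
  have "a - 1 < b - 1" "b - 1 < length hs" using assms by (auto simp: OI_def)
  then show ?thesis using assms(1) sorted_wrt_nth_less[of "(<)" hs] by (simp add: OI_def)
qed

lemma OI_nth_mem:
  assumes "hs \<in> OI n n'" "a \<in> {1..n}"
  shows "hs ! (a - 1) \<in> {1..n'}"
proof -
  have "hs ! (a - 1) \<in> set hs" using assms by (intro nth_mem) (auto simp: OI_def)
  then show ?thesis using assms(1) by (auto simp: OI_def)
qed

lemma push_OI:
  assumes hs: "hs \<in> OI m n" and fs: "fs \<in> OI d m"
  shows "push hs fs \<in> OI d n"
proof -
  have mem: "b \<in> {1..m}" if "b \<in> set fs" for b using fs that by (auto simp: OI_def)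
  have "sorted_wrt (<) (push hs fs)"
    unfolding push_def sorted_wrt_map
    by (rule sorted_wrt_mono_rel[of fs "(<)"]) (use fs mem OI_nth_less[OF hs] in \<open>auto simp: OI_def\<close>)
  moreover have "set (push hs fs) \<subseteq> {1..n}"
    using OI_nth_mem[OF hs] mem by (auto simp: push_def)
  ultimately show ?thesis using fs by (simp add: OI_def push_def)
qed

text \<open>At the first position where the lists differ, the strictly increasing \<open>hs\<close>
  keeps the direction of the inequality. This makes the lexicographic order a monomial
  order.\<close>

lemma push_less:
  assumes "hs \<in> OI m n" "fs \<in> OI d m" "gs \<in> OI d m" "fs < gs"
  shows "push hs fs < push hs gs"
proof -
  \<comment> \<open>Only the length and the range of the entries are kept as hypotheses, because
    tails of the lists no longer lie in \<open>OI d m\<close>.\<close>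
  have "push hs fs < push hs gs" if "length fs = length gs" "set fs \<subseteq> {1..m}" "set gs \<subseteq> {1..m}" "fs < gs"
    using that
  proof (induction fs gs rule: list_induct2)
    case (Cons x xs y ys)
    then show ?case using OI_nth_less[OF assms(1), of x y] by (auto simp: push_def)
  qed simp
  then show ?thesis using assms by (simp add: OI_def)
qed

text \<open>The gap inequalities say that the displacement from \<open>fs\<close> to
  \<open>gs\<close> is nondecreasing in the index. Shifting each point by the displacement of the
  last entry of \<open>fs\<close> at or before it is therefore strictly increasing.\<close>

lemma OI_factor:
  assumes fs: "fs \<in> OI d n" and gs: "gs \<in> OI d n'"
    and gap: "\<And>j. j \<le> d \<Longrightarrow> gap n fs j \<le> gap n' gs j"
  shows "\<exists>hs\<in>OI n n'. gs = push hs fs"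
proof -
  define f where "f j = (0 # fs @ [Suc n]) ! j" for j
  define g where "g j = (0 # gs @ [Suc n']) ! j" for j
  have len: "length fs = d" "length gs = d" using fs gs by (auto simp: OI_def)
  have f_less: "f i < f j" if "i < j" "j \<le> Suc d" for i j
    unfolding f_def using fs that
    by (intro sorted_wrt_nth_less[of "(<)"]) (auto simp: OI_def sorted_wrt_append)
  have g_less: "g i < g j" if "i < j" "j \<le> Suc d" for i j
    unfolding g_def using gs that
    by (intro sorted_wrt_nth_less[of "(<)"]) (auto simp: OI_def sorted_wrt_append)
  have f0: "f 0 = 0" "g 0 = 0" and fd: "f (Suc d) = Suc n" "g (Suc d) = Suc n'"
    using len by (auto simp: f_def g_def nth_append)
  \<comment> \<open>Stated additively, since subtraction of naturals truncates.\<close>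
  have step: "f (Suc j) + g j \<le> g (Suc j) + f j" if "j \<le> d" for j
    using gap[OF that] f_less[of j "Suc j"] g_less[of j "Suc j"] that
    unfolding gap_def f_def[symmetric] g_def[symmetric] by simp
  have mono: "f j + g i \<le> g j + f i" if "i \<le> j" "j \<le> Suc d" for i j
    using that
  proof (induction j rule: dec_induct)
    case (step m)
    then show ?case using \<open>\<And>j. j \<le> d \<Longrightarrow> f (Suc j) + g j \<le> g (Suc j) + f j\<close>[of m] by simp
  qed simp
  have fg: "f j \<le> g j" if "j \<le> Suc d" for j using mono[of 0 j] that f0 by simp
  \<comment> \<open>The index 0 always qualifies because \<open>f 0 = 0\<close>, so points before
    the first entry of \<open>fs\<close> are not moved.\<close>
  define J where "J a = Max {j. j \<le> d \<and> f j \<le> a}" for a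
  define h where "h a = a + (g (J a) - f (J a))" for a
  have fin: "finite {j. j \<le> d \<and> f j \<le> a}" for a by simp
  have J: "J a \<le> d \<and> f (J a) \<le> a" for a
  proof -
    have "0 \<in> {j. j \<le> d \<and> f j \<le> a}" using f0 by simp
    then have "J a \<in> {j. j \<le> d \<and> f j \<le> a}" unfolding J_def using fin by (intro Max_in) auto
    then show ?thesis by simp
  qed
  have J_mono: "J a \<le> J b" if "a \<le> b" for a b
    unfolding J_def by (rule Max_mono) (use that f0 in \<open>auto intro: exI[of _ 0]\<close>)
  have h_less: "h a < h b" if "a < b" for a b
    using that mono[of "J a" "J b"] J_mono[of a b] J[of a] J[of b] fg[of "J a"] fg[of "J b"]
    unfolding h_def by simp
  \<comment> \<open>Comparison with the index \<open>Suc d\<close>, where the values are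
    \<open>Suc n\<close> and \<open>Suc n'\<close>, bounds the shift by
    \<open>n' - n\<close>.\<close>
  have h_mem: "h a \<in> {1..n'}" if "a \<in> {1..n}" for a
    using that mono[of "J a" "Suc d"] J[of a] fd fg[of "J a"] unfolding h_def by auto
  have Jf: "J (f j) = j" if "j \<le> d" for j
    unfolding J_def
  proof (rule Max_eqI)
    show "y \<le> j" if y: "y \<in> {i. i \<le> d \<and> f i \<le> f j}" for y
      using f_less[of j y] y by (cases "j < y") auto
  qed (use that in auto)
  have hf: "h (f j) = g j" if "j \<le> d" for j
    using Jf[OF that] fg[of j] that by (simp add: h_def)
  define hs where "hs = map h [1..<Suc n]"
  have hs_nth: "hs ! (a - 1) = h a" if "a \<in> {1..n}" for a
  proof -
    have "a - 1 < Suc n - 1" "1 + (a - 1) = a" using that by auto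
    then show ?thesis using nth_map_upt[of "a - 1" "Suc n" 1 h] unfolding hs_def by simp
  qed
  have "hs \<in> OI n n'"
    using h_mem h_less
    by (auto simp: OI_def hs_def sorted_wrt_map simp del: upt_Suc
        intro!: sorted_wrt_mono_rel[OF _ sorted_wrt_upt])
  moreover have "gs = push hs fs"
  proof (rule nth_equalityI)
    show "length gs = length (push hs fs)" using len by (simp add: push_def)
    fix j assume j: "j < length gs"
    have "fs ! j \<in> set fs" using j len by simp
    then have "fs ! j \<in> {1..n}" using fs unfolding OI_def by blast
    moreover have "fs ! j = f (Suc j)" "gs ! j = g (Suc j)"
      using j len by (auto simp: f_def g_def nth_append)
    ultimately show "gs ! j = push hs fs ! j"
      using hf[of "Suc j"] j len hs_nth[of "fs ! j"] by (simp add: push_def)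
  qed
  ultimately show ?thesis by blast
qed

text \<open>Dickson's lemma, applied to gap vectors.\<close>
lemma OI_subseq:
  fixes s :: "nat \<Rightarrow> nat \<times> nat \<times> nat list"
  assumes s: "\<And>k. fst (snd (s k)) < N \<and> snd (snd (s k)) \<in> OI (d (fst (snd (s k)))) (fst (s k))"
  shows "\<exists>r::nat \<Rightarrow> nat. strict_mono r \<and> (\<forall>i j. i < j \<longrightarrow>
    fst (snd (s (r i))) = fst (snd (s (r j))) \<and>
    (\<exists>hs\<in>OI (fst (s (r i))) (fst (s (r j))). snd (snd (s (r j))) = push hs (snd (snd (s (r i))))))"
proof -
  define ix where "ix k = fst (snd (s k))" for k
  define dg where "dg k = fst (s k)" for k
  define fn where "fn k = snd (snd (s k))" for k
  \<comment> \<open>Finitely many generator indices occur, so one of them recurs infinitely often.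
    Along those terms all gap vectors have the same number of entries, one more than the length of
    the lists.\<close>
  have "finite (range ix)"
    by (rule finite_subset[of _ "{..<N}"]) (use s in \<open>auto simp: ix_def\<close>)
  then obtain k0 where "infinite {k \<in> UNIV. ix k = ix k0}"
    using pigeonhole_infinite[of UNIV ix] by auto
  then have inf: "infinite {k. ix k = ix k0}" by simp
  define e where "e = enumerate {k. ix k = ix k0}"
  have e: "strict_mono e" unfolding e_def using inf by (rule strict_mono_enumerate)
  have ixe: "ix (e i) = ix k0" for i using enumerate_in_set[OF inf, of i] by (simp add: e_def)
  obtain q :: "nat \<Rightarrow> nat" where q: "strict_mono q"
    "\<And>j. j < Suc (d (ix k0)) \<Longrightarrow> incseq (\<lambda>i. gap (dg (e (q i))) (fn (e (q i))) j)"
    using simultaneous_incseq_subseq[of "Suc (d (ix k0))" "\<lambda>i. gap (dg (e i)) (fn (e i))"] by blast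
  have fn: "fn (e i) \<in> OI (d (ix k0)) (dg (e i))" for i
    using s[of "e i"] ixe[of i] unfolding fn_def dg_def ix_def by simp
  have "\<exists>hs\<in>OI (dg (e (q i))) (dg (e (q j))). fn (e (q j)) = push hs (fn (e (q i)))" if "i < j" for i j
    using that q(2) by (intro OI_factor[OF fn fn]) (simp add: incseq_def)
  moreover have "strict_mono (\<lambda>i. e (q i))" using e q(1) by (simp add: strict_mono_def)
  ultimately show ?thesis
    unfolding fn_def[symmetric] dg_def[symmetric] ix_def[symmetric]
    by (intro exI[of _ "\<lambda>i. e (q i)"]) (simp add: ixe)
qed

section \<open>Spans and leading coefficients\<close>

text \<open>Linear combinations are built one summand at a time, with repetitions allowed, so that
  rule induction replaces finite sums and coefficient functions.\<close>

inductive_set mspan :: "('k, 'c) ring_scheme \<Rightarrow> ('k, 'm, 'd) module_scheme \<Rightarrow> 'm set \<Rightarrow> 'm set"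
  for R M A where
  zero: "\<zero>\<^bsub>M\<^esub> \<in> mspan R M A"
| step: "\<lbrakk>r \<in> carrier R; a \<in> A; x \<in> mspan R M A\<rbrakk> \<Longrightarrow> r \<odot>\<^bsub>M\<^esub> a \<oplus>\<^bsub>M\<^esub> x \<in> mspan R M A"

text \<open>In the application \<open>b\<close> is a monomial and \<open>L\<close> the span of the
  smaller ones. Monomials may satisfy linear relations, so \<open>c\<close> is not determined by
  \<open>u\<close>; the coefficients of all representations are collected.\<close>

definition lead :: "('k, 'c) ring_scheme \<Rightarrow> ('k, 'm, 'd) module_scheme \<Rightarrow> 'm set \<Rightarrow> 'm \<Rightarrow> 'm set \<Rightarrow> 'k set" where
  "lead R M H b L = {c \<in> carrier R. \<exists>u\<in>H. \<exists>v\<in>L. u = c \<odot>\<^bsub>M\<^esub> b \<oplus>\<^bsub>M\<^esub> v}"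

lemma module_hom_zero:
  assumes "module R M" "module R N" "h \<in> module_hom R M N"
  shows "h \<zero>\<^bsub>M\<^esub> = \<zero>\<^bsub>N\<^esub>"
proof -
  interpret M: module R M by fact
  interpret N: module R N by fact
  have "h (\<zero>\<^bsub>R\<^esub> \<odot>\<^bsub>M\<^esub> \<zero>\<^bsub>M\<^esub>) = \<zero>\<^bsub>R\<^esub> \<odot>\<^bsub>N\<^esub> h \<zero>\<^bsub>M\<^esub>"
    using assms(3) M.R.zero_closed M.M.zero_closed unfolding module_hom_def by blast
  moreover have "h \<zero>\<^bsub>M\<^esub> \<in> carrier N" using assms(3) by (auto simp: module_hom_def)
  ultimately show ?thesis by simp
qed

lemma mspan_mono: "A \<subseteq> B \<Longrightarrow> mspan R M A \<subseteq> mspan R M B"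
proof
  fix x assume "A \<subseteq> B" "x \<in> mspan R M A"
  from this(2,1) show "x \<in> mspan R M B"
    by (induction rule: mspan.induct) (auto intro: mspan.intros)
qed

lemma (in module) submodule_zero: "submodule H R M \<Longrightarrow> \<zero>\<^bsub>M\<^esub> \<in> H"
  using subgroup.one_closed[OF submodule.axioms(1), of H R M] by simp

lemma (in module) submodule_minus:
  assumes "submodule H R M" "x \<in> H" "y \<in> H"
  shows "x \<ominus>\<^bsub>M\<^esub> y \<in> H"
  using assms submoduleE(3,5)[OF assms(1)] by (simp add: a_minus_def)

lemma (in module) mspan_closed:
  assumes "A \<subseteq> carrier M" "x \<in> mspan R M A"
  shows "x \<in> carrier M"
  using assms(2,1) by (induction rule: mspan.induct) auto

lemma (in module) mspan_submodule:
  assumes A: "A \<subseteq> carrier M"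
  shows "submodule (mspan R M A) R M"
proof -
  note closed = mspan_closed[OF A]
  have smult: "r \<odot>\<^bsub>M\<^esub> x \<in> mspan R M A" if "r \<in> carrier R" "x \<in> mspan R M A" for r x
    using that(2)
  proof (induction rule: mspan.induct)
    case (step s a x)
    have "r \<odot>\<^bsub>M\<^esub> (s \<odot>\<^bsub>M\<^esub> a \<oplus>\<^bsub>M\<^esub> x) = (r \<otimes> s) \<odot>\<^bsub>M\<^esub> a \<oplus>\<^bsub>M\<^esub> r \<odot>\<^bsub>M\<^esub> x"
      using step closed that(1) A by (simp add: smult_r_distr smult_assoc1 subset_iff)
    then show ?case using step that(1) by (simp add: mspan.step)
  qed (use that in \<open>simp add: mspan.zero\<close>)
  show ?thesis
  proof (rule submoduleI)
    show "x \<oplus>\<^bsub>M\<^esub> y \<in> mspan R M A" if "x \<in> mspan R M A" "y \<in> mspan R M A" for x y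
      using that(1)
    proof (induction rule: mspan.induct)
      case (step s a x)
      have "s \<odot>\<^bsub>M\<^esub> a \<oplus>\<^bsub>M\<^esub> x \<oplus>\<^bsub>M\<^esub> y = s \<odot>\<^bsub>M\<^esub> a \<oplus>\<^bsub>M\<^esub> (x \<oplus>\<^bsub>M\<^esub> y)"
        using step closed that(2) A by (simp add: M.a_assoc subset_iff)
      then show ?case using step by (simp add: mspan.step)
    qed (use that closed in simp)
    show "\<ominus>\<^bsub>M\<^esub> x \<in> mspan R M A" if "x \<in> mspan R M A" for x
      using smult[of "\<ominus> \<one>" x] smult_l_minus[of \<one> x] closed[OF that] that by simp
  qed (use closed smult in \<open>auto intro: mspan.zero\<close>)
qed

lemma (in module) mspan_incl:
  assumes "A \<subseteq> carrier M" "a \<in> A"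
  shows "a \<in> mspan R M A"
proof -
  have "\<one> \<odot>\<^bsub>M\<^esub> a \<oplus>\<^bsub>M\<^esub> \<zero>\<^bsub>M\<^esub> \<in> mspan R M A"
    using assms by (intro mspan.intros) auto
  then show ?thesis using assms by auto
qed

lemma (in module) mspan_minimal:
  assumes H: "submodule H R M" and "A \<subseteq> H"
  shows "mspan R M A \<subseteq> H"
proof
  fix x assume "x \<in> mspan R M A"
  then show "x \<in> H"
    using assms(2) by (induction rule: mspan.induct) (auto simp: submodule_zero[OF H] submoduleE(4,5)[OF H])
qed

text \<open>By induction on the combination: a summand at \<open>b\<close> is absorbed into the
  coefficient \<open>c\<close>, any other one into the remainder. This isolates the leading
  term.\<close>

lemma (in module) mspan_insertE:
  assumes A: "insert b A \<subseteq> carrier M" and "u \<in> mspan R M (insert b A)"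
  shows "\<exists>c\<in>carrier R. \<exists>v\<in>mspan R M A. u = c \<odot>\<^bsub>M\<^esub> b \<oplus>\<^bsub>M\<^esub> v"
  using assms(2)
proof (induction rule: mspan.induct)
  case zero
  have "\<zero>\<^bsub>M\<^esub> = \<zero> \<odot>\<^bsub>M\<^esub> b \<oplus>\<^bsub>M\<^esub> \<zero>\<^bsub>M\<^esub>" using A by simp
  then show ?case using mspan.zero by blast
next
  case (step r a x)
  then obtain c v where cv: "c \<in> carrier R" "v \<in> mspan R M A" "x = c \<odot>\<^bsub>M\<^esub> b \<oplus>\<^bsub>M\<^esub> v" by blast
  have mem: "b \<in> carrier M" "a \<in> carrier M" "v \<in> carrier M"
    using A step cv mspan_closed[of A] by auto
  show ?case
  proof (cases "a = b")
    case True
    then have "r \<odot>\<^bsub>M\<^esub> a \<oplus>\<^bsub>M\<^esub> x = (r \<oplus> c) \<odot>\<^bsub>M\<^esub> b \<oplus>\<^bsub>M\<^esub> v"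
      using mem cv step by (simp add: smult_l_distr M.a_assoc)
    then show ?thesis using step cv by blast
  next
    case False
    have "r \<odot>\<^bsub>M\<^esub> a \<oplus>\<^bsub>M\<^esub> x = c \<odot>\<^bsub>M\<^esub> b \<oplus>\<^bsub>M\<^esub> (r \<odot>\<^bsub>M\<^esub> a \<oplus>\<^bsub>M\<^esub> v)"
      using mem cv step by (simp add: M.a_lcomm)
    moreover have "r \<odot>\<^bsub>M\<^esub> a \<oplus>\<^bsub>M\<^esub> v \<in> mspan R M A"
      using False step cv by (auto intro: mspan.step)
    ultimately show ?thesis using cv by blast
  qed
qed

lemma mspan_image:
  assumes M: "module R M" and N: "module R N" and h: "h \<in> module_hom R M N"
    and A: "A \<subseteq> carrier M" "h ` A \<subseteq> B"
  shows "h ` mspan R M A \<subseteq> mspan R N B"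
proof (intro subsetI, elim imageE)
  fix y x assume x: "x \<in> mspan R M A" and y: "y = h x"
  interpret M: module R M by fact
  have "h x \<in> mspan R N B"
    using x
  proof (induction rule: mspan.induct)
    case zero
    then show ?case by (simp add: module_hom_zero[OF M N h] mspan.zero)
  next
    case (step r a x)
    have "h (r \<odot>\<^bsub>M\<^esub> a \<oplus>\<^bsub>M\<^esub> x) = r \<odot>\<^bsub>N\<^esub> h a \<oplus>\<^bsub>N\<^esub> h x"
      using h step A M.mspan_closed[OF A(1)] by (simp add: module_hom_def subset_iff)
    then show ?case using step A by (auto intro: mspan.step)
  qed
  then show "y \<in> mspan R N B" using y by simp
qed

text \<open>Adding or scaling representations adds or scales their coefficients, since
  \<open>H\<close> and \<open>L\<close> are submodules. It lets the Noetherian hypothesis act on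
  leading coefficients.\<close>

lemma (in module) lead_ideal:
  assumes H: "submodule H R M" and L: "submodule L R M" and b: "b \<in> carrier M"
  shows "ideal (lead R M H b L) R"
proof -
  note mem = subsetD[OF submoduleE(1)[OF H]] subsetD[OF submoduleE(1)[OF L]]
  have smult: "x \<otimes> a \<in> lead R M H b L" if a: "a \<in> lead R M H b L" "x \<in> carrier R" for a x
  proof -
    obtain u v where uv: "u \<in> H" "v \<in> L" "u = a \<odot>\<^bsub>M\<^esub> b \<oplus>\<^bsub>M\<^esub> v" "a \<in> carrier R"
      using a by (auto simp: lead_def)
    have "x \<odot>\<^bsub>M\<^esub> u = (x \<otimes> a) \<odot>\<^bsub>M\<^esub> b \<oplus>\<^bsub>M\<^esub> x \<odot>\<^bsub>M\<^esub> v"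
      using uv a b mem by (simp add: smult_r_distr smult_assoc1)
    moreover have "x \<odot>\<^bsub>M\<^esub> u \<in> H" "x \<odot>\<^bsub>M\<^esub> v \<in> L"
      using submoduleE(4)[OF H] submoduleE(4)[OF L] uv a by auto
    ultimately show ?thesis using uv a by (auto simp: lead_def)
  qed
  have carr: "lead R M H b L \<subseteq> carrier R" by (auto simp: lead_def)
  have "subgroup (lead R M H b L) (add_monoid R)"
  proof (rule R.add.subgroupI)
    have "\<zero>\<^bsub>M\<^esub> = \<zero> \<odot>\<^bsub>M\<^esub> b \<oplus>\<^bsub>M\<^esub> \<zero>\<^bsub>M\<^esub>" using b by simp
    then have "\<zero> \<in> lead R M H b L"
      using submodule_zero[OF H] submodule_zero[OF L] unfolding lead_def by blast
    then show "lead R M H b L \<noteq> {}" by blast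
    show "\<ominus> a \<in> lead R M H b L" if "a \<in> lead R M H b L" for a
      using smult[OF that, of "\<ominus> \<one>"] that carr by (auto simp: R.l_minus)
    show "a \<oplus> c \<in> lead R M H b L" if ac: "a \<in> lead R M H b L" "c \<in> lead R M H b L" for a c
    proof -
      obtain u v where uv: "u \<in> H" "v \<in> L" "u = a \<odot>\<^bsub>M\<^esub> b \<oplus>\<^bsub>M\<^esub> v" "a \<in> carrier R"
        using ac unfolding lead_def by blast
      obtain u' v' where uv': "u' \<in> H" "v' \<in> L" "u' = c \<odot>\<^bsub>M\<^esub> b \<oplus>\<^bsub>M\<^esub> v'" "c \<in> carrier R"
        using ac unfolding lead_def by blast
      have "u \<oplus>\<^bsub>M\<^esub> u' = (a \<oplus> c) \<odot>\<^bsub>M\<^esub> b \<oplus>\<^bsub>M\<^esub> (v \<oplus>\<^bsub>M\<^esub> v')"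
        using uv uv' b mem by (simp add: smult_l_distr M.a_ac)
      moreover have "u \<oplus>\<^bsub>M\<^esub> u' \<in> H" "v \<oplus>\<^bsub>M\<^esub> v' \<in> L"
        using submoduleE(5)[OF H] submoduleE(5)[OF L] uv uv' by auto
      ultimately show ?thesis using uv uv' by (auto simp: lead_def)
    qed
  qed (use carr in auto)
  then show ?thesis
    using smult carr by (intro idealI) (auto simp: R.ring_axioms R.m_comm subset_iff)
qed

text \<open>A linear map carries a representation of \<open>u\<close> to one of \<open>h u\<close>
  with the same coefficient.\<close>

lemma lead_mono:
  assumes "module R M" "h \<in> module_hom R M N" "H \<subseteq> carrier M" "L \<subseteq> carrier M" "b \<in> carrier M"
    and "h ` H \<subseteq> H'" "h ` L \<subseteq> L'"
  shows "lead R M H b L \<subseteq> lead R N H' (h b) L'"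
proof
  interpret module R M by fact
  fix c assume "c \<in> lead R M H b L"
  then obtain u v where uv: "u \<in> H" "v \<in> L" "u = c \<odot>\<^bsub>M\<^esub> b \<oplus>\<^bsub>M\<^esub> v" "c \<in> carrier R"
    by (auto simp: lead_def)
  have "h u = c \<odot>\<^bsub>N\<^esub> h b \<oplus>\<^bsub>N\<^esub> h v"
    using uv assms by (simp add: module_hom_def subset_iff)
  moreover have "h u \<in> H'" "h v \<in> L'" using uv assms by auto
  ultimately show "c \<in> lead R N H' (h b) L'" using uv(4) unfolding lead_def by blast
qed

text \<open>Cancelling the leading term of an element of \<open>H\<close> against an element of \<open>H'\<close>.\<close>
lemma (in module) lead_reduce:
  assumes H: "submodule H R M" and H': "submodule H' R M" and L: "submodule L R M"
    and b: "b \<in> carrier M" and "H' \<subseteq> H" and lead: "lead R M H b L \<subseteq> lead R M H' b L"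
    and HL: "H \<inter> L \<subseteq> H'"
    and u: "u \<in> H" "c \<in> carrier R" "v \<in> L" "u = c \<odot>\<^bsub>M\<^esub> b \<oplus>\<^bsub>M\<^esub> v"
  shows "u \<in> H'"
proof -
  have "c \<in> lead R M H' b L" using lead u by (auto simp: lead_def)
  then obtain u' v' where uv': "u' \<in> H'" "v' \<in> L" "u' = c \<odot>\<^bsub>M\<^esub> b \<oplus>\<^bsub>M\<^esub> v'"
    by (auto simp: lead_def)
  have mem: "u' \<in> H" "u \<in> carrier M" "u' \<in> carrier M" "v \<in> carrier M" "v' \<in> carrier M"
    using uv' u submoduleE(1)[OF H] submoduleE(1)[OF L] \<open>H' \<subseteq> H\<close> by auto
  \<comment> \<open>The terms at \<open>b\<close> cancel, so the difference lies in both
    \<open>H\<close> and \<open>L\<close>, and \<open>HL\<close> places it in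
    \<open>H'\<close>.\<close>
  have "u \<ominus>\<^bsub>M\<^esub> u' = v \<ominus>\<^bsub>M\<^esub> v'"
  proof -
    have "u = c \<odot>\<^bsub>M\<^esub> b \<oplus>\<^bsub>M\<^esub> v' \<oplus>\<^bsub>M\<^esub> (v \<ominus>\<^bsub>M\<^esub> v')"
      using mem u b by (simp add: M.minus_eq M.a_ac M.r_neg2)
    then have "u = (v \<ominus>\<^bsub>M\<^esub> v') \<oplus>\<^bsub>M\<^esub> u'" using uv' mem by (simp add: M.a_comm)
    moreover have "v \<ominus>\<^bsub>M\<^esub> v' \<in> carrier M" using mem by simp
    ultimately show ?thesis using mem by (simp add: M.minus_eq[of _ u'] M.a_assoc M.r_neg)
  qed
  then have "u \<ominus>\<^bsub>M\<^esub> u' \<in> H'"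
    using HL submodule_minus[OF H u(1) mem(1)] submodule_minus[OF L u(3) uv'(2)] by auto
  moreover have "u = (u \<ominus>\<^bsub>M\<^esub> u') \<oplus>\<^bsub>M\<^esub> u'"
    using mem by (simp add: M.minus_eq M.a_assoc M.l_neg)
  ultimately show ?thesis using submoduleE(5)[OF H'] uv'(1) by metis
qed

section \<open>Factoring morphisms through order-preserving ones\<close>

text \<open>The list gives the values at positive arguments and is extended oddly to negative ones.
  Lists are indexed from 0, hence the shift by 1.\<close>

definition emb :: "nat list \<Rightarrow> int \<Rightarrow> int" where
  "emb fs = (\<lambda>a\<in>pm (length fs). sgn a * int (fs ! (nat \<bar>a\<bar> - 1)))"

lemma nat_abs_pm: "a \<in> pm n \<Longrightarrow> nat \<bar>a\<bar> \<in> {1..n}"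
  by (auto simp: pm_def)

lemma FI_hom_hom_BC: "f \<in> FI_hom W m n \<Longrightarrow> f \<in> hom_BC m n"
  by (cases W) (auto simp: hom_A_def hom_D_def)

lemma emb_abs_sgn:
  assumes "fs \<in> OI d n" "a \<in> pm d"
  shows "\<bar>emb fs a\<bar> = int (fs ! (nat \<bar>a\<bar> - 1))" "sgn (emb fs a) = sgn a" "emb fs a \<in> pm n"
proof -
  have len: "length fs = d" using assms(1) by (simp add: OI_def)
  have "fs ! (nat \<bar>a\<bar> - 1) \<in> {1..n}"
    using OI_nth_mem[OF assms(1) nat_abs_pm[OF assms(2)]] .
  moreover have "a \<noteq> 0" using assms(2) by (simp add: pm_def)
  then have "sgn a \<noteq> 0" by (simp add: sgn_if)
  ultimately show "\<bar>emb fs a\<bar> = int (fs ! (nat \<bar>a\<bar> - 1))" "sgn (emb fs a) = sgn a" "emb fs a \<in> pm n"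
    using assms(2) len by (auto simp: emb_def abs_mult sgn_mult pm_def)
qed

lemma emb_eqI:
  assumes "fs \<in> OI d n" "a \<in> pm d" "sgn x = sgn a" "\<bar>x\<bar> = int (fs ! (nat \<bar>a\<bar> - 1))"
  shows "emb fs a = x"
  using emb_abs_sgn[OF assms(1,2)] assms(3,4) by (metis mult_sgn_abs)

lemma inj_on_emb:
  assumes fs: "fs \<in> OI d n"
  shows "inj_on (emb fs) (pm d)"
proof (rule inj_onI)
  fix a b assume ab: "a \<in> pm d" "b \<in> pm d" "emb fs a = emb fs b"
  have "sgn a = sgn b" using emb_abs_sgn(2)[OF fs] ab by metis
  moreover have "fs ! (nat \<bar>a\<bar> - 1) = fs ! (nat \<bar>b\<bar> - 1)"
    using emb_abs_sgn(1)[OF fs] ab by (metis of_nat_eq_iff)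
  then have "nat \<bar>a\<bar> = nat \<bar>b\<bar>"
    using OI_nth_less[OF fs nat_abs_pm[OF ab(1)] nat_abs_pm[OF ab(2)]]
      OI_nth_less[OF fs nat_abs_pm[OF ab(2)] nat_abs_pm[OF ab(1)]] by (metis less_irrefl nat_neq_iff)
  ultimately show "a = b" by (metis abs_ge_zero eq_nat_nat_iff mult_sgn_abs)
qed

text \<open>No sign is reversed, so the number of reversed signs is 0, which is even; the parity
  condition of type D thus holds for isomorphisms too.\<close>

lemma emb_hom:
  assumes fs: "fs \<in> OI d n"
  shows "emb fs \<in> FI_hom W d n"
proof -
  have len: "length fs = d" using fs by (simp add: OI_def)
  have BC: "emb fs \<in> hom_BC d n"
    using emb_abs_sgn(3)[OF fs] inj_on_emb[OF fs] len
    by (auto simp: hom_BC_def emb_def PiE_def extensional_def)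
  have "\<not> (a > 0 \<and> emb fs a < 0)" if "a \<in> pm d" for a
    using emb_abs_sgn(2)[OF fs that] by (auto simp: sgn_if split: if_splits)
  then have "{a \<in> pm d. a > 0 \<and> emb fs a < 0} = {}" by blast
  then have "emb fs \<in> hom_D d n"
    using BC unfolding hom_D_def by (simp only: mem_Collect_eq card.empty) simp
  moreover have "emb fs \<in> hom_A d n"
    using BC emb_abs_sgn(2)[OF fs] by (simp add: hom_A_def)
  ultimately show ?thesis using BC by (cases W) simp_all
qed

lemma emb_push:
  assumes hs: "hs \<in> OI m n" and fs: "fs \<in> OI d m"
  shows "emb (push hs fs) = compose (pm d) (emb hs) (emb fs)"
proof
  fix a
  have len: "length fs = d" using fs by (simp add: OI_def)
  show "emb (push hs fs) a = compose (pm d) (emb hs) (emb fs) a"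
  proof (cases "a \<in> pm d")
    case True
    note e = emb_abs_sgn[OF fs True]
    have "nat \<bar>a\<bar> - 1 < d" using True len by (auto simp: pm_def)
    then have p: "push hs fs ! (nat \<bar>a\<bar> - 1) = hs ! (fs ! (nat \<bar>a\<bar> - 1) - 1)"
      using len by (simp add: push_def)
    have "emb (push hs fs) a = emb hs (emb fs a)"
      by (rule emb_eqI[OF push_OI[OF hs fs] True])
        (use p in \<open>simp_all add: emb_abs_sgn[OF hs e(3)] e(1,2)\<close>)
    then show ?thesis using True by (simp add: compose_def)
  qed (use len in \<open>simp add: emb_def compose_def push_def\<close>)
qed

lemma id_OI: "[1..<Suc n] \<in> OI n n"
  by (auto simp: OI_def simp del: upt_Suc)

lemma emb_id: "emb [1..<Suc n] = FI_id n"
proof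
  fix a show "emb [1..<Suc n] a = FI_id n a"
  proof (cases "a \<in> pm n")
    case True
    then have "nat \<bar>a\<bar> - 1 < Suc n - 1" "1 + (nat \<bar>a\<bar> - 1) = nat \<bar>a\<bar>" by (auto simp: pm_def)
    then have "[1..<Suc n] ! (nat \<bar>a\<bar> - 1) = nat \<bar>a\<bar>" by (simp del: upt_Suc)
    then have "emb [1..<Suc n] a = a"
      by (intro emb_eqI[OF id_OI True]) simp_all
    then show ?thesis using True by (simp add: FI_id_def)
  qed (simp add: emb_def FI_id_def del: upt_Suc)
qed

section \<open>Finiteness of hom sets and the factorization of morphisms\<close>

lemma finite_FI_hom: "finite (FI_hom W m n)"
proof (rule finite_subset)
  show "FI_hom W m n \<subseteq> pm m \<rightarrow>\<^sub>E pm n" using FI_hom_hom_BC by (force simp: hom_BC_def)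
  show "finite (pm m \<rightarrow>\<^sub>E pm n)" by (intro finite_PiE) auto
qed

lemma card_pm: "card (pm n) = 2 * n"
proof -
  have "pm n = {- int n..int n} - {0}" by (auto simp: pm_def)
  then show ?thesis by simp
qed

text \<open>A morphism that is not an isomorphism is factored through a source with one more element:
  then the first factor is never an isomorphism, so in type D it is not subject to the parity
  condition.\<close>
lemma FI_hom_factor:
  assumes f: "f \<in> FI_hom W m n"
  shows "\<exists>m'\<in>{m, Suc m}. \<exists>fs\<in>OI m' n. \<exists>f'\<in>FI_hom W m m'. f = compose (pm m) (emb fs) f'"
proof (cases "m = n")
  case True
  \<comment> \<open>For equal source and target the order-preserving factor is the identity.\<close>
  have "f = compose (pm m) (emb [1..<Suc n]) f"
    using FI_hom_hom_BC[OF f] True unfolding emb_id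
    by (intro ext) (auto simp: FI_id_def compose_def hom_BC_def PiE_def extensional_def)
  then show ?thesis using True f id_OI by blast
next
  case False
  have fB: "f \<in> hom_BC m n" by (rule FI_hom_hom_BC[OF f])
  have fpm: "f a \<in> pm n" if "a \<in> pm m" for a using fB that by (auto simp: hom_BC_def)
  have finj: "inj_on f (pm m)" using fB by (simp add: hom_BC_def)
  have fneg: "f (- a) = - f a" if "a \<in> pm m" for a using fB that by (simp add: hom_BC_def)
  have "card (pm m) \<le> card (pm n)"
    using finj fpm by (intro card_inj_on_le[of f]) auto
  then have mn: "m < n" using False by (simp add: card_pm)
  \<comment> \<open>The absolute values taken by \<open>f\<close>. There are \<open>m < n\<close> of
    them, so a further value \<open>t\<close> is free, and \<open>fs\<close> enumerates
    \<open>T0\<close> together with \<open>t\<close>.\<close>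
  define T0 where "T0 = (\<lambda>a. nat \<bar>f (int a)\<bar>) ` {1..m}"
  have T0n: "T0 \<subseteq> {1..n}" using nat_abs_pm[OF fpm] by (auto simp: T0_def pm_def)
  have fT0: "nat \<bar>f a\<bar> \<in> T0" if a: "a \<in> pm m" for a
  proof -
    have "\<bar>f a\<bar> = \<bar>f \<bar>a\<bar>\<bar>" using fneg[OF a] by (cases "a \<ge> 0") auto
    then have "nat \<bar>f a\<bar> = nat \<bar>f (int (nat \<bar>a\<bar>))\<bar>" by simp
    then show ?thesis unfolding T0_def using nat_abs_pm[OF a] by blast
  qed
  have "card T0 = m"
  proof -
    have "inj_on (\<lambda>a. nat \<bar>f (int a)\<bar>) {1..m}"
    proof (rule inj_onI)
      fix x y assume xy: "x \<in> {1..m}" "y \<in> {1..m}" "nat \<bar>f (int x)\<bar> = nat \<bar>f (int y)\<bar>"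
      then have p: "int x \<in> pm m" "int y \<in> pm m" by (auto simp: pm_def)
      have "\<bar>f (int x)\<bar> = \<bar>f (int y)\<bar>" using xy(3) by simp
      then have "f (int x) = f (int y) \<or> f (int x) = f (- int y)"
        using fneg[OF p(2)] by (auto simp: abs_eq_iff)
      moreover have "- int y \<in> pm m" using p(2) by simp
      ultimately have "int x = int y \<or> int x = - int y" using inj_onD[OF finj] p by blast
      then show "x = y" using xy by auto
    qed
    then show ?thesis by (simp add: T0_def card_image)
  qed
  then have "T0 \<noteq> {1..n}" using mn by auto
  then obtain t where t: "t \<in> {1..n}" "t \<notin> T0" using T0n by blast
  define fs where "fs = sorted_list_of_set (insert t T0)"
  have finT: "finite (insert t T0)" by (simp add: T0_def)
  have setfs: "set fs = insert t T0" using finT by (simp add: fs_def del: sorted_list_of_set_insert_remove)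
  have "length fs = Suc m"
    using finT t(2) \<open>card T0 = m\<close> by (simp add: fs_def del: sorted_list_of_set_insert_remove)
  then have fs: "fs \<in> OI (Suc m) n"
    using setfs t(1) T0n by (simp add: OI_def fs_def del: sorted_list_of_set_insert_remove)
  have range: "\<exists>b. b \<in> pm (Suc m) \<and> emb fs b = f a" if a: "a \<in> pm m" for a
  proof -
    have "nat \<bar>f a\<bar> \<in> set fs" using setfs fT0[OF a] by simp
    then obtain j where j: "j < Suc m" "fs ! j = nat \<bar>f a\<bar>"
      using \<open>length fs = Suc m\<close> by (metis in_set_conv_nth)
    have f0: "f a \<noteq> 0" using fpm[OF a] by (simp add: pm_def)
    then have "sgn (f a) \<noteq> 0" by (simp add: sgn_if)
    moreover define b where "b = sgn (f a) * int (Suc j)"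
    ultimately have b: "b \<in> pm (Suc m)" "sgn b = sgn (f a)" "nat \<bar>b\<bar> - 1 = j"
      using j f0 by (auto simp: b_def pm_def abs_mult sgn_mult nat_mult_distrib)
    have "emb fs b = f a" using b j by (intro emb_eqI[OF fs]) simp_all
    then show ?thesis using b by blast
  qed
  \<comment> \<open>\<open>f'\<close> is \<open>f\<close> followed by the inverse of
    \<open>emb fs\<close> on its image; injectivity of \<open>emb fs\<close> makes the choice unique
    and hence \<open>f'\<close> odd.\<close>
  define f' where "f' = (\<lambda>a\<in>pm m. SOME b. b \<in> pm (Suc m) \<and> emb fs b = f a)"
  have f': "f' a \<in> pm (Suc m)" "emb fs (f' a) = f a" if "a \<in> pm m" for a
    using someI_ex[OF range[OF that]] that by (simp_all add: f'_def)
  have embneg: "emb fs (- b) = - emb fs b" if "b \<in> pm (Suc m)" for b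
    using FI_hom_hom_BC[OF emb_hom[OF fs]] that by (simp add: hom_BC_def)
  have "f' (- a) = - f' a" if a: "a \<in> pm m" for a
  proof (rule inj_onD[OF inj_on_emb[OF fs]])
    show "emb fs (f' (- a)) = emb fs (- f' a)"
      using f'[of a] f'[of "- a"] a embneg fneg by simp
  qed (use f' a in auto)
  moreover have "inj_on f' (pm m)"
    using f'(2) finj by (metis inj_on_def)
  ultimately have BC: "f' \<in> hom_BC m (Suc m)"
    using f'(1) by (auto simp: hom_BC_def f'_def)
  have "\<not> bij_betw f' (pm m) (pm (Suc m))"
    using bij_betw_same_card[of f' "pm m" "pm (Suc m)"] by (auto simp: card_pm)
  then have D: "f' \<in> hom_D m (Suc m)" using BC by (simp add: hom_D_def)
  have "f' \<in> FI_hom W m (Suc m)"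
  proof (cases W)
    case Type_A
    then have "sgn (f' a) = sgn a" if "a \<in> pm m" for a
      using f f'[OF that] emb_abs_sgn(2)[OF fs f'(1)[OF that]] that by (simp add: hom_A_def)
    then show ?thesis using Type_A BC by (simp add: hom_A_def)
  qed (use BC D in auto)
  moreover have "f = compose (pm m) (emb fs) f'"
    using fB f'(2) by (intro ext) (auto simp: compose_def hom_BC_def PiE_def extensional_def)
  ultimately show ?thesis using fs by blast
qed

section \<open>Submodules and their leading ideals\<close>

lemma (in FI_module) act_closed:
  "\<lbrakk>f \<in> FI_hom W m n; x \<in> carrier (V m)\<rbrakk> \<Longrightarrow> act m n f x \<in> carrier (V n)"
  using act_hom[of f m n] by (auto simp: module_hom_def)

text \<open>The spans of all translates of a finite generating set form a sub-module containing that
  set, hence everything. Each translating morphism factors as an order-preserving one after one of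
  finitely many others, and these are applied to the generators beforehand.\<close>

lemma (in FI_module) fin_gen_list:
  assumes "fin_gen_FI R W V act"
  shows "\<exists>xs. (\<forall>i<length xs. snd (xs ! i) \<in> carrier (V (fst (xs ! i)))) \<and>
    (\<forall>n. carrier (V n) \<subseteq> mspan R (V n) {act d n (emb fs) x | d x fs. (d, x) \<in> set xs \<and> fs \<in> OI d n})"
proof -
  obtain S where S: "finite S" "S \<subseteq> (SIGMA n:UNIV. carrier (V n))"
    and gen: "\<And>U. \<lbrakk>sub_FI_module U R W V act; S \<subseteq> (SIGMA n:UNIV. U n)\<rbrakk> \<Longrightarrow> U = (\<lambda>n. carrier (V n))"
    using assms unfolding fin_gen_FI_def by blast
  define G where "G n = {act m n f x | m f x. (m, x) \<in> S \<and> f \<in> FI_hom W m n}" for n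
  have Gc: "G n \<subseteq> carrier (V n)" for n
    using S(2) act_closed by (fastforce simp: G_def)
  have "sub_FI_module (\<lambda>n. mspan R (V n) (G n)) R W V act"
    unfolding sub_FI_module_def
  proof (intro conjI allI ballI)
    show "submodule (mspan R (V n) (G n)) R (V n)" for n
      by (rule module.mspan_submodule[OF module_V Gc])
    fix m n f assume f: "f \<in> FI_hom W m n"
    have "act m n f ` G m \<subseteq> G n"
    proof (intro subsetI, elim imageE)
      fix z y assume "z = act m n f y" "y \<in> G m"
      then obtain l g x where "z = act m n f (act l m g x)" "(l, x) \<in> S" "g \<in> FI_hom W l m"
        by (auto simp: G_def)
      moreover from this have "z = act l n (compose (pm l) f g) x"
        using act_comp[of g l m f n x] f S(2) by auto
      ultimately show "z \<in> G n"
        using FI_comp_in_hom[of g W l m f n] f unfolding G_def by blast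
    qed
    then show "act m n f ` mspan R (V m) (G m) \<subseteq> mspan R (V n) (G n)"
      using mspan_image[OF module_V module_V act_hom[OF f] Gc] by blast
  qed
  moreover have "S \<subseteq> (SIGMA n:UNIV. mspan R (V n) (G n))"
  proof
    fix p assume p: "p \<in> S"
    obtain n x where nx: "p = (n, x)" by (cases p)
    then have "x = act n n (FI_id n) x" using act_id S(2) p by auto
    then have "x \<in> G n" using p nx FI_id_in_hom unfolding G_def by blast
    then show "p \<in> (SIGMA n:UNIV. mspan R (V n) (G n))"
      using nx module.mspan_incl[OF module_V Gc] by auto
  qed
  ultimately have top: "(\<lambda>n. mspan R (V n) (G n)) = (\<lambda>n. carrier (V n))" by (rule gen)
  \<comment> \<open>The images of the generators under all morphisms from degree \<open>m\<close> to
    degree \<open>m\<close> or \<open>Suc m\<close>; finite because the hom sets are.\<close>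
  define S' where "S' = (\<Union>(m, x)\<in>S. \<Union>m'\<in>{m, Suc m}. (\<lambda>f'. (m', act m m' f' x)) ` FI_hom W m m')"
  have "finite S'" unfolding S'_def using S(1) finite_FI_hom by (auto intro!: finite_UN_I)
  then obtain xs where xs: "set xs = S'" using finite_list by blast
  have memS': "x \<in> carrier (V d)" if "(d, x) \<in> S'" for d x
    using that S(2) act_closed by (fastforce simp: S'_def)
  have "snd (xs ! i) \<in> carrier (V (fst (xs ! i)))" if "i < length xs" for i
    using memS'[of "fst (xs ! i)" "snd (xs ! i)"] nth_mem[OF that] xs by simp
  moreover have "carrier (V n) \<subseteq> mspan R (V n) {act d n (emb fs) x | d x fs. (d, x) \<in> set xs \<and> fs \<in> OI d n}"
    for n
  proof -
    have "G n \<subseteq> {act d n (emb fs) x | d x fs. (d, x) \<in> set xs \<and> fs \<in> OI d n}"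
    proof
      fix z assume "z \<in> G n"
      then obtain m f x where z: "z = act m n f x" "(m, x) \<in> S" "f \<in> FI_hom W m n"
        by (auto simp: G_def)
      obtain m' fs f' where f: "m' \<in> {m, Suc m}" "fs \<in> OI m' n" "f' \<in> FI_hom W m m'"
        "f = compose (pm m) (emb fs) f'"
        using FI_hom_factor[OF z(3)] by blast
      have "z = act m' n (emb fs) (act m m' f' x)"
        using z f act_comp[OF f(3) emb_hom[OF f(2)]] S(2) by auto
      moreover have "(m', act m m' f' x) \<in> set xs"
        unfolding xs S'_def using z(2) f(1,3) by blast
      ultimately show "z \<in> {act d n (emb fs) x | d x fs. (d, x) \<in> set xs \<and> fs \<in> OI d n}"
        using f(2) by blast
    qed
    then show ?thesis using mspan_mono fun_cong[OF top, of n] by blast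
  qed
  ultimately show ?thesis by blast
qed

text \<open>Stability is asked only under order-preserving morphisms. The leading-ideal argument
  uses no others, so the three types are treated at once.\<close>

definition OI_submodule ::
  "('k, 'c) ring_scheme \<Rightarrow> (nat \<Rightarrow> ('k, 'm, 'd) module_scheme)
     \<Rightarrow> (nat \<Rightarrow> nat \<Rightarrow> (int \<Rightarrow> int) \<Rightarrow> 'm \<Rightarrow> 'm) \<Rightarrow> (nat \<Rightarrow> 'm set) \<Rightarrow> bool" where
  "OI_submodule R V act U \<longleftrightarrow> (\<forall>n. submodule (U n) R (V n)) \<and>
     (\<forall>m n. \<forall>hs\<in>OI m n. act m n (emb hs) ` U m \<subseteq> U n)"

text \<open>A monomial of degree \<open>n\<close> is a pair \<open>(i, fs)\<close>, standing for the image of the \<open>i\<close>-th generator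
  under \<open>emb fs\<close>. Monomials are compared lexicographically: first \<open>i\<close>, then \<open>fs\<close>.\<close>
locale FI_module_gens = FI_module +
  fixes xs :: "(nat \<times> 'b) list"
  assumes xs_mem: "i < length xs \<Longrightarrow> snd (xs ! i) \<in> carrier (V (fst (xs ! i)))"
    and xs_gen: "carrier (V n) \<subseteq>
      mspan R (V n) {act d n (emb fs) x | d x fs. (d, x) \<in> set xs \<and> fs \<in> OI d n}"
    and noeth: "noetherian_ring R"
begin

definition mons :: "nat \<Rightarrow> (nat \<times> nat list) set" where
  "mons n = {m. fst m < length xs \<and> snd m \<in> OI (fst (xs ! fst m)) n}"

definition ev :: "nat \<Rightarrow> nat \<times> nat list \<Rightarrow> 'b" where
  "ev n m = act (fst (xs ! fst m)) n (emb (snd m)) (snd (xs ! fst m))"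

definition low :: "nat \<Rightarrow> nat \<times> nat list \<Rightarrow> 'b set" where
  "low n m = mspan R (V n) (ev n ` {m' \<in> mons n. m' < m})"

text \<open>The argument is a degree followed by a monomial of that degree, because a list of values
  does not determine its target.\<close>

definition lc :: "(nat \<Rightarrow> 'b set) \<Rightarrow> nat \<times> nat \<times> nat list \<Rightarrow> 'a set" where
  "lc U p = lead R (V (fst p)) (U (fst p)) (ev (fst p) (snd p)) (low (fst p) (snd p))"

text \<open>Divisibility of monomials: \<open>q\<close> is an order-preserving translate of
  \<open>p\<close>, for the same generator.\<close>

definition div_le :: "nat \<times> nat \<times> nat list \<Rightarrow> nat \<times> nat \<times> nat list \<Rightarrow> bool" where
  "div_le p q \<longleftrightarrow> fst (snd p) = fst (snd q) \<and>
     (\<exists>hs\<in>OI (fst p) (fst q). snd (snd q) = push hs (snd (snd p)))"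

lemma finite_mons: "finite (mons n)"
  by (rule finite_subset[of _ "SIGMA i:{..<length xs}. OI (fst (xs ! i)) n"])
    (auto simp: mons_def finite_OI)

lemma ev_closed: "m \<in> mons n \<Longrightarrow> ev n m \<in> carrier (V n)"
  unfolding ev_def mons_def by (auto intro!: act_closed emb_hom xs_mem)

lemma ev_mons_closed: "ev n ` {m' \<in> mons n. P m'} \<subseteq> carrier (V n)"
  using ev_closed by auto

lemma low_submodule: "submodule (low n m) R (V n)"
  unfolding low_def by (rule module.mspan_submodule[OF module_V ev_mons_closed])

lemma low_carrier: "low n m \<subseteq> carrier (V n)"
  by (rule module.submoduleE(1)[OF module_V low_submodule])

lemma push_mons:
  assumes "m \<in> mons n" "hs \<in> OI n n'"
  shows "(fst m, push hs (snd m)) \<in> mons n'"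
    and "ev n' (fst m, push hs (snd m)) = act n n' (emb hs) (ev n m)"
  using assms push_OI[of hs n n'] emb_push[of hs n n']
    act_comp[OF emb_hom emb_hom[OF assms(2)]] xs_mem
  by (auto simp: mons_def ev_def)

lemma push_mons_less:
  assumes "m \<in> mons n" "m' \<in> mons n" "hs \<in> OI n n'" "m' < m"
  shows "(fst m', push hs (snd m')) < (fst m, push hs (snd m))"
  using assms push_less[OF assms(3)] by (cases m; cases m') (auto simp: mons_def)

text \<open>Composition preserves the monomial order, so monomials below \<open>m\<close> go to
  monomials below the translate of \<open>m\<close>.\<close>

lemma act_low:
  assumes m: "m \<in> mons n" and hs: "hs \<in> OI n n'"
  shows "act n n' (emb hs) ` low n m \<subseteq> low n' (fst m, push hs (snd m))"
  unfolding low_def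
proof (rule mspan_image[OF module_V module_V act_hom[OF emb_hom[OF hs]] ev_mons_closed])
  show "act n n' (emb hs) ` ev n ` {m' \<in> mons n. m' < m}
    \<subseteq> ev n' ` {m' \<in> mons n'. m' < (fst m, push hs (snd m))}"
  proof (intro subsetI, elim imageE)
    fix y z m' assume "y = act n n' (emb hs) z" "z = ev n m'" and m': "m' \<in> {m' \<in> mons n. m' < m}"
    then have "y = ev n' (fst m', push hs (snd m'))" using push_mons(2)[of m' n hs n'] hs by simp
    moreover have "(fst m', push hs (snd m')) \<in> {m' \<in> mons n'. m' < (fst m, push hs (snd m))}"
      using m' push_mons(1)[OF _ hs] push_mons_less[OF m _ hs] by simp
    ultimately show "y \<in> ev n' ` {m' \<in> mons n'. m' < (fst m, push hs (snd m))}" by (rule image_eqI)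
  qed
qed

lemma lc_ideal:
  assumes "OI_submodule R V act U" "snd p \<in> mons (fst p)"
  shows "ideal (lc U p) R"
  using assms module.lead_ideal[OF module_V] low_submodule ev_closed
  by (simp add: lc_def OI_submodule_def)

text \<open>The map induced by \<open>hs\<close> sends \<open>U\<close>, the monomial of
  \<open>p\<close> and the span below it into their counterparts at \<open>q\<close>, so every
  leading coefficient at \<open>p\<close> is also one at \<open>q\<close>.\<close>

lemma lc_mono:
  assumes U: "OI_submodule R V act U" and p: "snd p \<in> mons (fst p)" and pq: "div_le p q"
  shows "lc U p \<subseteq> lc U q"
proof -
  obtain hs where hs: "hs \<in> OI (fst p) (fst q)" and q: "snd q = (fst (snd p), push hs (snd (snd p)))"
    using pq by (auto simp: div_le_def prod_eq_iff)
  have "U (fst p) \<subseteq> carrier (V (fst p))" "act (fst p) (fst q) (emb hs) ` U (fst p) \<subseteq> U (fst q)"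
    using U hs module.submoduleE(1)[OF module_V] by (simp_all add: OI_submodule_def)
  then show ?thesis
    unfolding lc_def q push_mons(2)[OF p hs]
    by (intro lead_mono[OF module_V act_hom[OF emb_hom[OF hs]]])
      (use act_low[OF p hs] low_carrier ev_closed[OF p] in auto)
qed

lemma mons_generate: "carrier (V n) \<subseteq> mspan R (V n) (ev n ` mons n)"
proof -
  have "{act d n (emb fs) x | d x fs. (d, x) \<in> set xs \<and> fs \<in> OI d n} \<subseteq> ev n ` mons n"
  proof clarify
    fix d x fs assume "(d, x) \<in> set xs" "fs \<in> OI d n"
    then obtain i where "i < length xs" "xs ! i = (d, x)" by (metis in_set_conv_nth)
    then show "act d n (emb fs) x \<in> ev n ` mons n"
      using \<open>fs \<in> OI d n\<close> by (intro image_eqI[of _ _ "(i, fs)"]) (auto simp: ev_def mons_def)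
  qed
  then show ?thesis using xs_gen mspan_mono by blast
qed

text \<open>The division argument: the leading term of an element of \<open>U\<close> is cancelled
  by an element of \<open>U'\<close>, leaving an element of \<open>U\<close> in the span of smaller
  monomials. It ends because each degree has finitely many monomials.\<close>

lemma subset_if_lc_subset:
  assumes U: "OI_submodule R V act U" and U': "OI_submodule R V act U'" and sub: "\<And>n. U' n \<subseteq> U n"
    and lc: "\<And>n m. m \<in> mons n \<Longrightarrow> lc U (n, m) \<subseteq> lc U' (n, m)"
  shows "U n \<subseteq> U' n"
proof -
  interpret module R "V n" by (rule module_V)
  have Us: "submodule (U n) R (V n)" and U's: "submodule (U' n) R (V n)"
    using U U' by (auto simp: OI_submodule_def)
  \<comment> \<open>\<open>D\<close> runs through the initial segments of the monomials of degree
    \<open>n\<close>; the condition stays inside the formula because the induction over finite sets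
    adds one maximal element at a time.\<close>
  have "D \<subseteq> mons n \<and> (\<forall>a\<in>D. \<forall>m\<in>mons n. m < a \<longrightarrow> m \<in> D) \<longrightarrow> U n \<inter> mspan R (V n) (ev n ` D) \<subseteq> U' n"
    if "finite D" for D
    using that
  proof (induction D rule: finite_linorder_max_induct)
    case empty
    have "x = \<zero>\<^bsub>V n\<^esub>" if "x \<in> mspan R (V n) {}" for x
      using that by (cases rule: mspan.cases) auto
    then show ?case using submodule_zero[OF U's] by auto
  next
    case (insert b A)
    show ?case
    proof (intro impI subsetI, elim conjE IntE)
      fix u assume D: "insert b A \<subseteq> mons n" "\<forall>a\<in>insert b A. \<forall>m\<in>mons n. m < a \<longrightarrow> m \<in> insert b A"
        and u: "u \<in> U n" "u \<in> mspan R (V n) (ev n ` insert b A)"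
      \<comment> \<open>Since \<open>b\<close> exceeds all of \<open>A\<close> and
        \<open>insert b A\<close> is downward closed, \<open>A\<close> consists of all monomials
        below \<open>b\<close>, and its span is \<open>low n b\<close>.\<close>
      have A: "A = {m \<in> mons n. m < b}" using D insert.hyps by auto
      have low: "low n b = mspan R (V n) (ev n ` A)" by (simp add: low_def A)
      have "\<forall>a\<in>A. \<forall>m\<in>mons n. m < a \<longrightarrow> m \<in> A" unfolding A using less_trans by blast
      then have IH: "U n \<inter> low n b \<subseteq> U' n" using insert.IH D low by auto
      have b: "b \<in> mons n" using D by simp
      have "insert (ev n b) (ev n ` A) \<subseteq> carrier (V n)" using D ev_closed by auto
      moreover have "u \<in> mspan R (V n) (insert (ev n b) (ev n ` A))" using u(2) by simp
      ultimately obtain c v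
        where "c \<in> carrier R" "v \<in> low n b" "u = c \<odot>\<^bsub>V n\<^esub> ev n b \<oplus>\<^bsub>V n\<^esub> v"
        unfolding low using mspan_insertE by blast
      then show "u \<in> U' n"
        using lead_reduce[OF Us U's low_submodule ev_closed[OF b] sub _ IH u(1)] lc[OF b]
        by (simp add: lc_def)
    qed
  qed
  from this[OF finite_mons] have "U n \<inter> mspan R (V n) (ev n ` mons n) \<subseteq> U' n" by blast
  then show ?thesis using mons_generate submoduleE(1)[OF Us] by blast
qed

text \<open>\<open>T\<close> is a Groebner basis: for each of finitely many monomials whose leading
  ideals account for all others, every generator of the ideal is lifted to an element of
  \<open>U\<close>. A submodule of \<open>U\<close> containing \<open>T\<close> has the same leading
  ideals.\<close>

lemma OI_submodule_generators:
  assumes U: "OI_submodule R V act U"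
  shows "\<exists>T. finite T \<and> T \<subseteq> (SIGMA n:UNIV. U n) \<and>
    (\<forall>U'. OI_submodule R V act U' \<and> (\<forall>n. U' n \<subseteq> U n) \<and> T \<subseteq> (SIGMA n:UNIV. U' n) \<longrightarrow> U' = U)"
proof -
  define M where "M = {p. snd p \<in> mons (fst p)}"
  have "\<exists>F\<subseteq>M. finite F \<and> (\<forall>q\<in>M. \<exists>p\<in>F. div_le p q \<and> lc U p = lc U q)"
  proof (rule finite_basis[OF _ _ noeth])
    fix s :: "nat \<Rightarrow> nat \<times> nat \<times> nat list" assume s: "range s \<subseteq> M"
    then have "fst (snd (s k)) < length xs \<and> snd (snd (s k)) \<in> OI (fst (xs ! fst (snd (s k)))) (fst (s k))" for k
    proof -
      have "s k \<in> M" using s by blast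
      then show ?thesis by (simp add: M_def mons_def)
    qed
    from OI_subseq[where s = s and N = "length xs" and d = "\<lambda>i. fst (xs ! i)", OF this]
    show "\<exists>r::nat \<Rightarrow> nat. strict_mono r \<and> (\<forall>i j. i < j \<longrightarrow> div_le (s (r i)) (s (r j)))"
      unfolding div_le_def .
  qed (use lc_mono[OF U] lc_ideal[OF U] in \<open>auto simp: M_def\<close>)
  then obtain F where F: "F \<subseteq> M" "finite F" "\<And>q. q \<in> M \<Longrightarrow> \<exists>p\<in>F. div_le p q \<and> lc U p = lc U q"
    by blast
  have "\<forall>p\<in>F. \<exists>A. A \<subseteq> carrier R \<and> finite A \<and> lc U p = genideal R A"
    using noetherian_ring.finetely_gen[OF noeth lc_ideal[OF U]] F(1) by (auto simp: M_def subset_iff)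
  then obtain A where A: "\<And>p. p \<in> F \<Longrightarrow> A p \<subseteq> carrier R \<and> finite (A p) \<and> lc U p = genideal R (A p)"
    by metis
  interpret ring R using noeth by (simp add: noetherian_ring_def)
  have "\<exists>u\<in>U (fst p). \<exists>v\<in>low (fst p) (snd p). u = c \<odot>\<^bsub>V (fst p)\<^esub> ev (fst p) (snd p) \<oplus>\<^bsub>V (fst p)\<^esub> v"
    if "p \<in> F" "c \<in> A p" for p c
  proof -
    have "c \<in> lc U p" using A[OF that(1)] that(2) genideal_self[of "A p"] by blast
    then show ?thesis by (simp add: lc_def lead_def)
  qed
  \<comment> \<open>\<open>w p c\<close> is an element of \<open>U\<close> with leading coefficient
    \<open>c\<close> at the monomial of \<open>p\<close>.\<close>
  then obtain w where w: "\<And>p c. \<lbrakk>p \<in> F; c \<in> A p\<rbrakk> \<Longrightarrow> w p c \<in> U (fst p) \<and>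
      (\<exists>v\<in>low (fst p) (snd p). w p c = c \<odot>\<^bsub>V (fst p)\<^esub> ev (fst p) (snd p) \<oplus>\<^bsub>V (fst p)\<^esub> v)"
    by metis
  define T where "T = (\<Union>p\<in>F. (\<lambda>c. (fst p, w p c)) ` A p)"
  have "finite T" unfolding T_def using F(2) A by auto
  moreover have "T \<subseteq> (SIGMA n:UNIV. U n)" unfolding T_def using w by auto
  moreover have "\<forall>U'. OI_submodule R V act U' \<and> (\<forall>n. U' n \<subseteq> U n) \<and> T \<subseteq> (SIGMA n:UNIV. U' n) \<longrightarrow> U' = U"
  proof (intro allI impI, elim conjE)
    fix U' assume U': "OI_submodule R V act U'" and "\<forall>n. U' n \<subseteq> U n" and T: "T \<subseteq> (SIGMA n:UNIV. U' n)"
    then have sub: "U' n \<subseteq> U n" for n by simp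
    have "lc U (n, m) \<subseteq> lc U' (n, m)" if m: "m \<in> mons n" for n m
    proof -
      obtain p where p: "p \<in> F" "div_le p (n, m)" "lc U p = lc U (n, m)"
        using F(3)[of "(n, m)"] m by (auto simp: M_def)
      have pM: "snd p \<in> mons (fst p)" using p(1) F(1) by (auto simp: M_def)
      have "A p \<subseteq> lc U' p"
      proof
        fix c assume c: "c \<in> A p"
        have "(fst p, w p c) \<in> T" using p(1) c by (auto simp: T_def)
        then have "w p c \<in> U' (fst p)" using T by auto
        then show "c \<in> lc U' p"
          using w[OF p(1) c] c A[OF p(1)] unfolding lc_def lead_def by blast
      qed
      then have "lc U p \<subseteq> lc U' p"
        using A[OF p(1)] genideal_minimal[OF lc_ideal[OF U' pM]] by simp
      then show ?thesis using lc_mono[OF U' pM p(2)] p(3) by blast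
    qed
    then have "U n \<subseteq> U' n" for n by (rule subset_if_lc_subset[OF U U' sub])
    then show "U' = U" using sub by (intro ext) blast
  qed
  ultimately show ?thesis by (intro exI[of _ T] conjI)
qed

end

section \<open>Submodules of a submodule, and the final deduction\<close>

lemma submodule_restrict:
  assumes "module R M" "submodule U R M" "submodule U' R (M\<lparr>carrier := U\<rparr>)"
  shows "submodule U' R M" "U' \<subseteq> U"
proof -
  interpret M: module R M by fact
  interpret MU: module R "M\<lparr>carrier := U\<rparr>"
    by (rule submodule.submodule_is_module[OF assms(2,1)])
  show sub: "U' \<subseteq> U" using MU.submoduleE(1)[OF assms(3)] by simp
  have U: "U \<subseteq> carrier M" by (rule M.submoduleE(1)[OF assms(2)])
  have smult: "a \<odot>\<^bsub>M\<^esub> x \<in> U'" if "a \<in> carrier R" "x \<in> U'" for a x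
    using MU.submoduleE(4)[OF assms(3) that] by simp
  show "submodule U' R M"
  proof (rule M.submoduleI)
    \<comment> \<open>The additive inverse depends on the carrier, so the one of \<open>M\<close> is
      reached through multiplication by minus one, which both modules share.\<close>
    show "\<ominus>\<^bsub>M\<^esub> a \<in> U'" if "a \<in> U'" for a
    proof -
      have "a \<in> carrier M" using that sub U by auto
      then show ?thesis using smult[of "\<ominus>\<^bsub>R\<^esub> \<one>\<^bsub>R\<^esub>" a] that by (simp add: M.smult_l_minus)
    qed
  qed (use sub U smult MU.submodule_zero[OF assms(3)] MU.submoduleE(5)[OF assms(3)] in auto)
qed

theorem theorem4p21:
  fixes R :: "('k, 'c) ring_scheme"
    and W :: weyl_type
    and V :: "nat \<Rightarrow> ('k, 'm, 'd) module_scheme"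
    and act :: "nat \<Rightarrow> nat \<Rightarrow> (int \<Rightarrow> int) \<Rightarrow> 'm \<Rightarrow> 'm"
    and U :: "nat \<Rightarrow> 'm set"
  assumes "cring R" and "noetherian_ring R"
    and "FI_module R W V act"
    and "fin_gen_FI R W V act"
    and "sub_FI_module U R W V act"
  shows "fin_gen_FI R W (restrict_FI V U) act"
proof -
  interpret FI_module R W V act by fact
  obtain xs where "\<forall>i<length xs. snd (xs ! i) \<in> carrier (V (fst (xs ! i)))"
    "\<forall>n. carrier (V n) \<subseteq> mspan R (V n) {act d n (emb fs) x | d x fs. (d, x) \<in> set xs \<and> fs \<in> OI d n}"
    using fin_gen_list[OF assms(4)] by blast
  then interpret FI_module_gens R W V act xs
    by (intro FI_module_gens.intro FI_module_axioms FI_module_gens_axioms.intro) (use assms(2) in auto)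
  have OI: "OI_submodule R V act U'" if "sub_FI_module U' R W V act" for U'
    using that emb_hom by (auto simp: OI_submodule_def sub_FI_module_def)
  have U: "submodule (U n) R (V n)" for n using assms(5) by (simp add: sub_FI_module_def)
  obtain T where T: "finite T" "T \<subseteq> (SIGMA n:UNIV. U n)"
    "\<forall>U'. OI_submodule R V act U' \<and> (\<forall>n. U' n \<subseteq> U n) \<and> T \<subseteq> (SIGMA n:UNIV. U' n) \<longrightarrow> U' = U"
    using OI_submodule_generators[OF OI[OF assms(5)]] by (elim exE conjE)
  \<comment> \<open>A sub-module of the restriction is one of \<open>V\<close> lying inside
    \<open>U\<close>, so the defining property of \<open>T\<close> rules out a proper one containing
    \<open>T\<close>.\<close>
  have "U' = U" if U': "sub_FI_module U' R W (restrict_FI V U) act" and "T \<subseteq> (SIGMA n:UNIV. U' n)" for U'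
  proof (rule T(3)[rule_format, OF conjI[OF _ conjI]])
    have "submodule (U' n) R ((V n)\<lparr>carrier := U n\<rparr>)" for n
      using U' by (simp add: sub_FI_module_def restrict_FI_def)
    note sub = submodule_restrict[OF module_V U this]
    show "OI_submodule R V act U'"
      using U' sub(1) by (intro OI) (simp add: sub_FI_module_def)
    show "\<forall>n. U' n \<subseteq> U n" using sub(2) by simp
  qed fact
  then show ?thesis
    unfolding fin_gen_FI_def using T(1,2) by (intro exI[of _ T]) (auto simp: restrict_FI_def)
qed

end
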